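(* Let $t>2$ be an integer and let $G$ be a connected graph with $n$ vertices, $m$ edges, minimum degree $\delta(G)$, and spectral radius $\rho(G)$. Let $k_t(G)$ denote the maximum number of edge-disjoint $t$-cliques in $G$. Then $$k_t(G)\leq\frac{2m-\rho(G)-(n-t+1)\left\lceil\frac{\delta(G)}{t-1}\right\rceil}{t(t-2)},$$ with equality if and only if $G$ is regular and has a $K_t$-decomposition.
   Context: Graphs are finite, simple and undirected. The spectral radius $\rho(G)$ is the largest eigenvalue of the adjacency matrix of $G$. A clique in $G$ is a vertex set $Q\subseteq V(G)$ such that the subgraph induced on $Q$ is complete; a $t$-clique is a clique with exactly $t$ vertices. Cliques are edge-disjoint if no edge of $G$ is contained in two of them. A $K_t$-decomposition of $G$ is a set of $t$-cliques of $G$ such that each edge of $G$ belongs to exactly one of them (for an edgeless graph the empty set is a $K_t$-decomposition). *)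

theory Defs
  imports "HOL-Analysis.Analysis"
begin

text \<open>
  A finite simple graph with vertex set the (finite, nonempty) type \<open>'v\<close> is given by its set of
  edges, each edge being a two-element set of vertices.
\<close>

definition simple_graph :: "'v::finite set set \<Rightarrow> bool" where
  "simple_graph E \<longleftrightarrow> (\<forall>e\<in>E. card e = 2)"

definition adjacent :: "'v::finite set set \<Rightarrow> 'v \<Rightarrow> 'v \<Rightarrow> bool" where
  "adjacent E u v \<longleftrightarrow> {u, v} \<in> E"

definition connected_graph :: "'v::finite set set \<Rightarrow> bool" where
  "connected_graph E \<longleftrightarrow> (\<forall>u v. (adjacent E)\<^sup>*\<^sup>* u v)"

definition vertex_degree :: "'v::finite set set \<Rightarrow> 'v \<Rightarrow> nat" where
  "vertex_degree E v = card {e \<in> E. v \<in> e}"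

definition min_degree :: "'v::finite set set \<Rightarrow> nat" where
  "min_degree E = Min (range (vertex_degree E))"

definition regular_graph :: "'v::finite set set \<Rightarrow> bool" where
  "regular_graph E \<longleftrightarrow> (\<exists>d. \<forall>v. vertex_degree E v = d)"

definition adjacency_matrix :: "'v::finite set set \<Rightarrow> real^'v^'v" where
  "adjacency_matrix E = (\<chi> u v. if adjacent E u v then 1 else 0)"

definition eigenvalue :: "real^'v^'v \<Rightarrow> real \<Rightarrow> bool" where
  "eigenvalue A c \<longleftrightarrow> (\<exists>x. x \<noteq> 0 \<and> A *v x = c *s x)"

text \<open>
  An adjacency matrix is symmetric, so its eigenvalues are all real, and they form a finite
  nonempty set.
\<close>

definition spectral_radius :: "'v::finite set set \<Rightarrow> real" where
  "spectral_radius E = Max {c. eigenvalue (adjacency_matrix E) c}"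

definition clique :: "'v::finite set set \<Rightarrow> 'v set \<Rightarrow> bool" where
  "clique E Q \<longleftrightarrow> (\<forall>u\<in>Q. \<forall>v\<in>Q. u \<noteq> v \<longrightarrow> adjacent E u v)"

definition cliques_of_size :: "nat \<Rightarrow> 'v::finite set set \<Rightarrow> 'v set set" where
  "cliques_of_size t E = {Q. clique E Q \<and> card Q = t}"

definition edge_disjoint :: "'v::finite set set \<Rightarrow> 'v set set \<Rightarrow> bool" where
  "edge_disjoint E \<Q> \<longleftrightarrow> (\<forall>e\<in>E. \<forall>P\<in>\<Q>. \<forall>Q\<in>\<Q>. e \<subseteq> P \<and> e \<subseteq> Q \<longrightarrow> P = Q)"

definition max_edge_disjoint_cliques :: "nat \<Rightarrow> 'v::finite set set \<Rightarrow> nat" where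
  "max_edge_disjoint_cliques t E =
     Max {card \<Q> | \<Q>. \<Q> \<subseteq> cliques_of_size t E \<and> edge_disjoint E \<Q>}"

definition clique_decomposition :: "nat \<Rightarrow> 'v::finite set set \<Rightarrow> 'v set set \<Rightarrow> bool" where
  "clique_decomposition t E \<Q> \<longleftrightarrow>
     \<Q> \<subseteq> cliques_of_size t E \<and> (\<forall>e\<in>E. \<exists>!Q. Q \<in> \<Q> \<and> e \<subseteq> Q)"

end

theory Submission
  imports Defs
begin

text \<open>
  Complete a maximum family of \<open>k\<close> edge-disjoint \<open>t\<close>-cliques by the uncovered edges to a partition of
  the edge set into cliques of size at most \<open>t\<close>, and let \<open>r v\<close> be the number of parts containing
  \<open>v\<close>. Double counting gives \<open>\<Sum>v. r v = 2m - k t (t - 2)\<close>, and \<open>r v \<ge> c\<close> for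
  \<open>c = \<lceil>\<delta> / (t - 1)\<rceil>\<close>. The neighbours of \<open>v\<close> are distributed over the \<open>r v\<close> parts through \<open>v\<close>,
  and the sum of \<open>r\<close> over one part without \<open>v\<close> is at most
  \<open>\<mu> = (t - 1) c + (\<Sum>v. r v - c)\<close>. Hence \<open>r\<close> is a positive weight with \<open>A r \<le> \<mu> r\<close>,
  so \<open>\<rho> \<le> \<mu>\<close>, which is the claimed bound. If \<open>\<rho> = \<mu>\<close>, connectedness forces \<open>A r = \<mu> r\<close>, and then
  \<open>r\<close> is constantly \<open>c\<close> and all parts have size \<open>t\<close>.
\<close>

section \<open>Eigenvalues of symmetric matrices\<close>

lemma symmetric_dot:
  fixes A :: "real^'n^'n"
  assumes "transpose A = A"
  shows "x \<bullet> (A *v y) = (A *v x) \<bullet> y"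
  by (metis assms dot_lmul_matrix vector_transpose_matrix)

text \<open>Eigenvectors of a symmetric matrix for distinct eigenvalues are orthogonal. One chosen
  eigenvector per eigenvalue thus gives an independent, hence finite, set. This makes the
  \<open>Max\<close> in \<open>spectral_radius\<close> meaningful.\<close>

lemma finite_eigenvalues:
  fixes A :: "real^'n^'n"
  assumes "transpose A = A"
  shows "finite {c. eigenvalue A c}"
proof -
  define f where "f c = (SOME x. x \<noteq> 0 \<and> A *v x = c *s x)" for c
  have f: "f c \<noteq> 0 \<and> A *v f c = c *s f c" if "eigenvalue A c" for c
    unfolding f_def by (rule someI_ex) (use that in \<open>simp add: eigenvalue_def\<close>)
  let ?S = "{c. eigenvalue A c}"
  have orth: "f c \<bullet> f d = 0" if "eigenvalue A c" "eigenvalue A d" "c \<noteq> d" for c d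
  proof -
    have "c * (f c \<bullet> f d) = d * (f c \<bullet> f d)"
      using symmetric_dot[OF assms, of "f c" "f d"] f[OF that(1)] f[OF that(2)]
      by (auto simp: scalar_mult_eq_scaleR)
    then show ?thesis using that(3) by simp
  qed
  have "inj_on f ?S"
  proof (rule inj_onI, rule ccontr)
    fix c d assume *: "c \<in> ?S" "d \<in> ?S" "f c = f d" "c \<noteq> d"
    then have "f c \<bullet> f c = 0" using orth[of c d] by simp
    then show False using f[of c] * by simp
  qed
  moreover have "finite (f ` ?S)"
  proof (rule independent_imp_finite, rule pairwise_orthogonal_independent)
    show "pairwise orthogonal (f ` ?S)"
      using orth by (auto simp: pairwise_def orthogonal_def)
    show "0 \<notin> f ` ?S" using f by force
  qed
  ultimately show ?thesis using finite_imageD by blast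
qed

text \<open>Near 0 a nonzero linear term would outweigh the quadratic one and change sign. This
  serves as the first-order condition at a maximizer of the Rayleigh quotient.\<close>

lemma linear_coeff_eq_0:
  fixes a b :: real
  assumes "\<And>s. 0 \<le> 2 * s * a + s\<^sup>2 * b"
  shows "a = 0"
proof (rule ccontr)
  assume a: "a \<noteq> 0"
  \<comment> \<open>Replacing \<open>b\<close> by a positive upper bound \<open>q\<close> gives an
    upward parabola with minimum at \<open>- a / q\<close>, where its value is negative.\<close>
  define q where "q = \<bar>b\<bar> + 1"
  have q: "q > 0" "b \<le> q" by (auto simp: q_def)
  define s where "s = - a / q"
  have "2 * s * a + s\<^sup>2 * b \<le> 2 * s * a + s\<^sup>2 * q"
    using q(2) by (intro add_left_mono mult_left_mono) auto
  also have "\<dots> = - a\<^sup>2 / q"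
    unfolding s_def using q(1) by (simp add: field_simps power2_eq_square)
  also have "\<dots> < 0" using a q(1) by (simp add: divide_neg_pos)
  finally show False using assms[of s] by simp
qed

text \<open>A maximizer of the Rayleigh quotient is an eigenvector.\<close>

lemma eigenvalue_exists:
  fixes A :: "real^'n^'n"
  assumes A: "transpose A = A"
  shows "\<exists>c. eigenvalue A c"
proof -
  have cont: "continuous_on (sphere 0 1) (\<lambda>x. x \<bullet> (A *v x))"
    by (intro continuous_intros matrix_vector_mult_linear_continuous_on)
  have "(axis undefined 1 :: real^'n) \<in> sphere 0 1" by simp
  then obtain x where x: "norm x = 1" and mx: "\<And>y. norm y = 1 \<Longrightarrow> y \<bullet> (A *v y) \<le> x \<bullet> (A *v x)"
    using continuous_attains_sup[OF compact_sphere _ cont] by fastforce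
  define m where "m = x \<bullet> (A *v x)"
  have le: "y \<bullet> (A *v y) \<le> m * (y \<bullet> y)" for y
  proof (cases "y = 0")
    case False
    let ?z = "(1 / norm y) *\<^sub>R y"
    have "?z \<bullet> (A *v ?z) \<le> m" unfolding m_def by (rule mx) (use False in simp)
    then have "(y \<bullet> (A *v y)) / (norm y)\<^sup>2 \<le> m"
      by (simp add: matrix_vector_mult_scaleR power2_eq_square)
    then show ?thesis using False by (simp add: field_simps power2_norm_eq_inner)
  qed simp
  \<comment> \<open>The form \<open>m * (y \<bullet> y) - y \<bullet> (A *v y)\<close> is
    nonnegative and vanishes at \<open>x\<close>. Along \<open>x + s *\<^sub>R y\<close> its linear
    coefficient is \<open>2 * (y \<bullet> z)\<close>, so \<open>z\<close> is orthogonal to every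
    \<open>y\<close>.\<close>
  define z where "z = m *\<^sub>R x - A *v x"
  have "y \<bullet> z = 0" for y
  proof (rule linear_coeff_eq_0)
    fix s :: real
    have "(x + s *\<^sub>R y) \<bullet> (A *v (x + s *\<^sub>R y)) \<le> m * ((x + s *\<^sub>R y) \<bullet> (x + s *\<^sub>R y))"
      by (rule le)
    moreover have "x \<bullet> (A *v y) = y \<bullet> (A *v x)"
      using symmetric_dot[OF A] by (metis inner_commute)
    moreover have "x \<bullet> x = 1" using x by (simp add: norm_eq_1)
    ultimately show "0 \<le> 2 * s * (y \<bullet> z) + s\<^sup>2 * (m * (y \<bullet> y) - y \<bullet> (A *v y))"
      unfolding z_def
      by (simp add: m_def matrix_vector_right_distrib matrix_vector_mult_scaleR inner_add_left
          inner_add_right inner_diff_right inner_commute[of x y] algebra_simps power2_eq_square)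
  qed
  then have "z = 0" by (metis inner_eq_zero_iff)
  then have "x \<noteq> 0 \<and> A *v x = m *s x"
    using x by (auto simp: z_def scalar_mult_eq_scaleR)
  then show ?thesis unfolding eigenvalue_def by blast
qed

section \<open>The spectrum of an adjacency matrix\<close>

lemma adjacent_commute: "adjacent E u v \<longleftrightarrow> adjacent E v u"
  by (simp add: adjacent_def insert_commute)

lemma transpose_adjacency_matrix: "transpose (adjacency_matrix E) = adjacency_matrix E"
  by (simp add: transpose_def adjacency_matrix_def vec_eq_iff adjacent_commute)

lemma eigenvalue_spectral_radius: "eigenvalue (adjacency_matrix E) (spectral_radius E)"
proof -
  have "spectral_radius E \<in> {c. eigenvalue (adjacency_matrix E) c}"
    unfolding spectral_radius_def
    by (rule Max_in)
       (use finite_eigenvalues[OF transpose_adjacency_matrix]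
          eigenvalue_exists[OF transpose_adjacency_matrix] in auto)
  then show ?thesis by simp
qed

lemma eigenvalue_le_spectral_radius:
  "eigenvalue (adjacency_matrix E) c \<Longrightarrow> c \<le> spectral_radius E"
  unfolding spectral_radius_def
  by (rule Max_ge) (use finite_eigenvalues[OF transpose_adjacency_matrix] in auto)

lemma adjacency_matrix_mult_nth:
  "(adjacency_matrix E *v x) $ v = (\<Sum>u | adjacent E v u. x $ u)"
proof -
  have "(adjacency_matrix E *v x) $ v = (\<Sum>u\<in>UNIV. if adjacent E v u then x $ u else 0)"
    unfolding matrix_vector_mult_def adjacency_matrix_def
    by (auto intro!: sum.cong)
  also have "\<dots> = (\<Sum>u | adjacent E v u. x $ u)"
    by (simp add: sum.If_cases)
  finally show ?thesis .
qed

text \<open>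
  The Collatz--Wielandt bound: where \<open>\<bar>x\<bar> / w\<close> is maximal, the eigenvalue equation is
  dominated by the weighted row sum; under equality maximality spreads to all neighbours.
\<close>

lemma eigenvalue_le_weighted_row_sum:
  fixes w :: "'v::finite \<Rightarrow> real"
  assumes conn: "connected_graph E"
    and ev: "eigenvalue (adjacency_matrix E) c"
    and w: "\<And>v. w v > 0"
    and row: "\<And>v. (\<Sum>u | adjacent E v u. w u) \<le> \<mu> * w v"
  shows "c \<le> \<mu>" and "c = \<mu> \<Longrightarrow> (\<Sum>u | adjacent E v u. w u) = \<mu> * w v"
proof -
  obtain x where x: "x \<noteq> 0" and Ax: "adjacency_matrix E *v x = c *s x"
    using ev unfolding eigenvalue_def by blast
  define q where "q v = \<bar>x $ v\<bar> / w v" for v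
  define M where "M = Max (range q)"
  have xq: "\<bar>x $ v\<bar> = q v * w v" for v using w[of v] by (simp add: q_def)
  have qM: "q v \<le> M" for v unfolding M_def by simp
  obtain i where i: "x $ i \<noteq> 0" using x by (metis vec_eq_iff zero_index)
  have "0 < q i" using i w by (simp add: q_def)
  then have M0: "0 < M" using qM[of i] by simp
  have "M \<in> range q" unfolding M_def by (rule Max_in) auto
  then obtain j where j: "q j = M" by auto
  have key: "c * (M * w v) \<le> (\<Sum>u | adjacent E v u. q u * w u)" if "q v = M" for v
  proof -
    have "c * (M * w v) = c * \<bar>x $ v\<bar>" using that xq by simp
    also have "\<dots> \<le> \<bar>c * x $ v\<bar>" by (simp add: abs_mult mult_right_mono)
    also have "\<dots> = \<bar>\<Sum>u | adjacent E v u. x $ u\<bar>"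
      by (metis Ax adjacency_matrix_mult_nth vector_smult_component)
    also have "\<dots> \<le> (\<Sum>u | adjacent E v u. \<bar>x $ u\<bar>)" by (rule sum_abs)
    finally show ?thesis by (simp add: xq)
  qed
  have le: "(\<Sum>u | adjacent E v u. q u * w u) \<le> M * (\<Sum>u | adjacent E v u. w u)" for v
    unfolding sum_distrib_left using w qM by (intro sum_mono mult_right_mono) (auto simp: less_imp_le)
  have le2: "M * (\<Sum>u | adjacent E v u. w u) \<le> M * (\<mu> * w v)" for v
    using row M0 by simp
  have "c * (M * w j) \<le> \<mu> * (M * w j)"
    using key[OF j] le[of j] le2[of j] by (simp add: ac_simps)
  then show "c \<le> \<mu>" using M0 w[of j] by (simp add: mult_le_cancel_right)
  assume c: "c = \<mu>"
  have eqs: "(\<Sum>u | adjacent E v u. q u * w u) = M * (\<Sum>u | adjacent E v u. w u)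
      \<and> (\<Sum>u | adjacent E v u. w u) = \<mu> * w v" if "q v = M" for v
  proof -
    have "M * (\<mu> * w v) \<le> (\<Sum>u | adjacent E v u. q u * w u)"
      using key[OF that] c by (simp add: ac_simps)
    then have "(\<Sum>u | adjacent E v u. q u * w u) = M * (\<Sum>u | adjacent E v u. w u)"
      and "M * (\<Sum>u | adjacent E v u. w u) = M * (\<mu> * w v)"
      using le[of v] le2[of v] by linarith+
    then show ?thesis using M0 by simp
  qed
  \<comment> \<open>At a vertex with maximal ratio the weighted average of the neighbouring ratios
    is again \<open>M\<close>, and all weights are positive, so no neighbour can fall below
    \<open>M\<close>.\<close>
  have step: "q u = M" if "q v = M" "adjacent E v u" for u v
  proof (rule ccontr)
    assume "q u \<noteq> M"
    then have "q u < M" using qM[of u] by simp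
    then have "(\<Sum>u | adjacent E v u. q u * w u) < (\<Sum>u | adjacent E v u. M * w u)"
      using that(2) w qM
      by (intro sum_strict_mono_ex1) (auto simp: less_imp_le mult_right_mono intro!: exI[of _ u])
    then show False using eqs[OF that(1)] unfolding sum_distrib_left[symmetric] by simp
  qed
  have "(adjacent E)\<^sup>*\<^sup>* j v" using conn by (simp add: connected_graph_def)
  then have "q v = M" by induction (use j step in auto)
  then show "(\<Sum>u | adjacent E v u. w u) = \<mu> * w v" using eqs by blast
qed

section \<open>Degrees\<close>

lemma adjacent_neq: "simple_graph E \<Longrightarrow> adjacent E u v \<Longrightarrow> u \<noteq> v"
  by (auto simp: simple_graph_def adjacent_def)

lemma vertex_degree_eq_card_adjacent:
  assumes "simple_graph E"
  shows "vertex_degree E v = card {u. adjacent E v u}"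
proof -
  have "{e \<in> E. v \<in> e} = (\<lambda>u. {v, u}) ` {u. adjacent E v u}"
  proof
    show "{e \<in> E. v \<in> e} \<subseteq> (\<lambda>u. {v, u}) ` {u. adjacent E v u}"
    proof
      fix e assume e: "e \<in> {e \<in> E. v \<in> e}"
      then have "card e = 2" using assms by (auto simp: simple_graph_def)
      then obtain a b where "e = {a, b}" by (auto simp: card_2_iff)
      then obtain u where "e = {v, u}" using e by auto
      then show "e \<in> (\<lambda>u. {v, u}) ` {u. adjacent E v u}"
        using e by (auto simp: adjacent_def)
    qed
  qed (auto simp: adjacent_def)
  moreover have "inj_on (\<lambda>u. {v, u}) {u. adjacent E v u}"
    by (auto simp: inj_on_def doubleton_eq_iff)
  ultimately show ?thesis
    unfolding vertex_degree_def by (simp add: card_image)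
qed

lemma min_degree_le: "min_degree E \<le> vertex_degree E v"
  unfolding min_degree_def by simp

lemma min_degree_regular:
  assumes "\<And>v. vertex_degree E v = d"
  shows "min_degree E = d"
proof -
  have "range (vertex_degree E) = {d}" using assms by auto
  then show ?thesis by (simp add: min_degree_def)
qed

text \<open>The all-ones vector is an eigenvector; this supplies the lower bound on the spectral
  radius in the equality case.\<close>

lemma eigenvalue_regular:
  assumes "simple_graph E" and "\<And>v. vertex_degree E v = d"
  shows "eigenvalue (adjacency_matrix E) (real d)"
  unfolding eigenvalue_def
proof (intro exI conjI)
  show "(1 :: real^'a) \<noteq> 0" by (simp add: vec_eq_iff)
  show "adjacency_matrix E *v 1 = real d *s 1"
    using assms by (simp add: vec_eq_iff adjacency_matrix_mult_nth vertex_degree_eq_card_adjacent)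
qed

text \<open>An edge provides a second vertex, and a path from any vertex to a different one has a
  first edge. Positivity is what later makes the weight \<open>r\<close> positive.\<close>

lemma min_degree_pos:
  assumes s: "simple_graph E" and conn: "connected_graph E" and ne: "E \<noteq> {}"
  shows "min_degree E > 0"
proof -
  obtain e where "e \<in> E" using ne by auto
  then have "card e = 2" using s by (simp add: simple_graph_def)
  then obtain a b :: 'a where ab: "a \<noteq> b" by (auto simp: card_2_iff)
  have "vertex_degree E v > 0" for v
  proof -
    obtain u where u: "u \<noteq> v" using ab by metis
    have "(adjacent E)\<^sup>*\<^sup>* v u" using conn by (simp add: connected_graph_def)
    then obtain y where "adjacent E v y" using u by (metis converse_rtranclpE)
    then show ?thesis
      by (auto simp: vertex_degree_eq_card_adjacent[OF s] card_gt_0_iff)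
  qed
  then show ?thesis unfolding min_degree_def by simp
qed

text \<open>The common source of all incidence counts below: constant \<open>g\<close> gives the
  handshake lemma and the sum of clique degrees, while \<open>card P - 1\<close> counts edges
  through the parts.\<close>

lemma sum_card_containing:
  fixes F :: "'v::finite set set" and g :: "'v set \<Rightarrow> nat"
  shows "(\<Sum>v\<in>UNIV. \<Sum>P | P \<in> F \<and> v \<in> P. g P) = (\<Sum>P\<in>F. card P * g P)"
proof -
  have "(\<Sum>v\<in>UNIV. \<Sum>P | P \<in> F \<and> v \<in> P. g P)
      = (\<Sum>P\<in>F. \<Sum>v | v \<in> UNIV \<and> v \<in> P. g P)"
    by (rule sum.swap_restrict) auto
  then show ?thesis by simp
qed

lemma sum_vertex_degree:
  assumes "simple_graph E"
  shows "(\<Sum>v\<in>UNIV. vertex_degree E v) = 2 * card E"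
proof -
  have "(\<Sum>v\<in>UNIV. vertex_degree E v) = (\<Sum>e\<in>E. card e)"
    using sum_card_containing[of "\<lambda>_. 1" E] by (simp add: vertex_degree_def)
  also have "\<dots> = (\<Sum>e\<in>E. 2)" using assms by (intro sum.cong) (auto simp: simple_graph_def)
  finally show ?thesis by simp
qed

section \<open>Clique partitions\<close>

text \<open>Upper bounds on part sizes are left to the individual lemmas, since the same notion
  serves completed families, with parts of size at most \<open>t\<close>, and exact
  decompositions.\<close>

definition clique_partition :: "'v::finite set set \<Rightarrow> 'v set set \<Rightarrow> bool" where
  "clique_partition E \<P> \<longleftrightarrow>
     (\<forall>P\<in>\<P>. clique E P \<and> 2 \<le> card P) \<and> (\<forall>e\<in>E. \<exists>!P. P \<in> \<P> \<and> e \<subseteq> P)"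

definition clique_degree :: "'v::finite set set \<Rightarrow> 'v \<Rightarrow> nat" where
  "clique_degree \<P> v = card {P \<in> \<P>. v \<in> P}"

lemma sum_clique_degree:
  "(\<Sum>v\<in>UNIV. clique_degree \<P> v) = (\<Sum>P\<in>\<P>. card P)"
  using sum_card_containing[of "\<lambda>_. 1" \<P>] by (simp add: clique_degree_def)

text \<open>Two parts through \<open>v\<close> share no other vertex \<open>u\<close>, as both would
  contain the edge \<open>{v, u}\<close>. So they split the neighbourhood of \<open>v\<close>.
  Taking \<open>f\<close> constant yields degrees, taking \<open>f\<close> to be the clique degree
  yields weighted row sums.\<close>

lemma sum_adjacent_clique_partition:
  assumes s: "simple_graph E" and part: "clique_partition E \<P>"
  shows "(\<Sum>u | adjacent E v u. f u) = (\<Sum>P | P \<in> \<P> \<and> v \<in> P. \<Sum>u\<in>P - {v}. f u)"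
proof -
  have "{u. adjacent E v u} = (\<Union>P\<in>{P \<in> \<P>. v \<in> P}. P - {v})"
  proof (intro set_eqI iffI)
    fix u assume "u \<in> {u. adjacent E v u}"
    then have u: "adjacent E v u" by simp
    then obtain P where "P \<in> \<P>" "{v, u} \<subseteq> P"
      using part unfolding clique_partition_def adjacent_def by blast
    then show "u \<in> (\<Union>P\<in>{P \<in> \<P>. v \<in> P}. P - {v})" using adjacent_neq[OF s u] by auto
  next
    fix u assume "u \<in> (\<Union>P\<in>{P \<in> \<P>. v \<in> P}. P - {v})"
    then show "u \<in> {u. adjacent E v u}"
      using part unfolding clique_partition_def clique_def by auto
  qed
  moreover have "(\<Sum>u\<in>(\<Union>P\<in>{P \<in> \<P>. v \<in> P}. P - {v}). f u)
      = (\<Sum>P | P \<in> \<P> \<and> v \<in> P. \<Sum>u\<in>P - {v}. f u)"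
  proof (rule sum.UNION_disjoint)
    show "\<forall>P\<in>{P \<in> \<P>. v \<in> P}. \<forall>Q\<in>{P \<in> \<P>. v \<in> P}. P \<noteq> Q \<longrightarrow> (P - {v}) \<inter> (Q - {v}) = {}"
    proof (intro ballI impI, rule ccontr)
      fix P Q assume PQ: "P \<in> {P \<in> \<P>. v \<in> P}" "Q \<in> {P \<in> \<P>. v \<in> P}" "P \<noteq> Q"
        and "(P - {v}) \<inter> (Q - {v}) \<noteq> {}"
      then obtain u where u: "u \<in> P" "u \<in> Q" "u \<noteq> v" by auto
      then have "{v, u} \<in> E"
        using PQ part unfolding clique_partition_def clique_def adjacent_def by blast
      then have "\<exists>!P. P \<in> \<P> \<and> {v, u} \<subseteq> P"
        using part unfolding clique_partition_def by blast
      then show False using PQ u by auto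
    qed
  qed auto
  ultimately show ?thesis by simp
qed

lemma vertex_degree_clique_partition:
  assumes "simple_graph E" and "clique_partition E \<P>"
  shows "vertex_degree E v = (\<Sum>P | P \<in> \<P> \<and> v \<in> P. card P - 1)"
proof -
  have "vertex_degree E v = (\<Sum>u | adjacent E v u. 1)"
    using assms by (simp add: vertex_degree_eq_card_adjacent)
  also have "\<dots> = (\<Sum>P | P \<in> \<P> \<and> v \<in> P. \<Sum>u\<in>P - {v}. 1)"
    by (rule sum_adjacent_clique_partition[OF assms])
  also have "\<dots> = (\<Sum>P | P \<in> \<P> \<and> v \<in> P. card P - 1)"
    by (intro sum.cong) auto
  finally show ?thesis .
qed

lemma two_card_edges_clique_partition:
  assumes "simple_graph E" and "clique_partition E \<P>"
  shows "2 * card E = (\<Sum>P\<in>\<P>. card P * (card P - 1))"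
  using sum_vertex_degree[OF assms(1)] sum_card_containing[of "\<lambda>P. card P - 1" \<P>]
  by (simp add: vertex_degree_clique_partition[OF assms])

text \<open>Each part through \<open>v\<close> accounts for at most \<open>t - 1\<close> neighbours.
  As clique degrees are integers, this bounds them below by the ceiling in the theorem.\<close>

lemma vertex_degree_le_clique_degree:
  assumes "simple_graph E" and "clique_partition E \<P>" and "\<And>P. P \<in> \<P> \<Longrightarrow> card P \<le> t"
  shows "vertex_degree E v \<le> (t - 1) * clique_degree \<P> v"
proof -
  have "(\<Sum>P | P \<in> \<P> \<and> v \<in> P. card P - 1) \<le> (\<Sum>P | P \<in> \<P> \<and> v \<in> P. t - 1)"
    using assms(3) by (intro sum_mono diff_le_mono) auto
  then show ?thesis
    by (simp add: vertex_degree_clique_partition[OF assms(1,2)] clique_degree_def mult.commute)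
qed

lemma vertex_degree_uniform_clique_partition:
  assumes "simple_graph E" and "clique_partition E \<P>" and "\<And>P. P \<in> \<P> \<Longrightarrow> card P = t"
  shows "vertex_degree E v = (t - 1) * clique_degree \<P> v"
proof -
  have "(\<Sum>P | P \<in> \<P> \<and> v \<in> P. card P - 1) = (\<Sum>P | P \<in> \<P> \<and> v \<in> P. t - 1)"
    using assms(3) by (intro sum.cong) auto
  then show ?thesis
    by (simp add: vertex_degree_clique_partition[OF assms(1,2)] clique_degree_def mult.commute)
qed

lemma eigenvalue_le_clique_partition:
  fixes E :: "'v::finite set set" and c \<theta> :: real
  assumes s: "simple_graph E" and conn: "connected_graph E"
    and part: "clique_partition E \<P>" and t: "\<And>P. P \<in> \<P> \<Longrightarrow> card P \<le> t"
    and c0: "c > 0" and c: "\<And>v. c \<le> clique_degree \<P> v"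
    and ev: "eigenvalue (adjacency_matrix E) \<theta>"
  defines "\<mu> \<equiv> (real t - 1) * c + (\<Sum>v\<in>UNIV. clique_degree \<P> v - c)"
  shows "\<theta> \<le> \<mu>"
    and "\<theta> = \<mu> \<Longrightarrow> clique_degree \<P> v = c"
    and "\<theta> = \<mu> \<Longrightarrow> P \<in> \<P> \<Longrightarrow> card P = t"
proof -
  define r where "r v = real (clique_degree \<P> v)" for v
  define S where "S = (\<Sum>v\<in>UNIV. r v - c)"
  have \<mu>: "\<mu> = (real t - 1) * c + S" by (simp add: \<mu>_def S_def r_def)
  have rc: "c \<le> r v" for v using c by (simp add: r_def)
  have r0: "r v > 0" for v using rc[of v] c0 by simp
  \<comment> \<open>All excesses \<open>r u - c\<close> are nonnegative, so those in
    \<open>P - {v}\<close> total at most \<open>S\<close> minus the excess of \<open>v\<close>. That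
    last term is dropped for the bound but kept here, because equality will force it to
    vanish.\<close>
  have part_sum: "(\<Sum>u\<in>P - {v}. r u) \<le> (real (card P) - 1) * c + S - (r v - c)"
    if "P \<in> \<P>" "v \<in> P" for P v
  proof -
    have "(\<Sum>u\<in>P - {v}. r u) = (\<Sum>u\<in>P - {v}. c) + (\<Sum>u\<in>P - {v}. r u - c)"
      by (simp add: sum_subtractf)
    also have "(\<Sum>u\<in>P - {v}. c) = (real (card P) - 1) * c"
      using that(2) card_gt_0_iff[of P] by (auto simp: of_nat_diff Suc_le_eq)
    also have "(\<Sum>u\<in>P - {v}. r u - c) \<le> (\<Sum>u\<in>UNIV - {v}. r u - c)"
      using rc by (intro sum_mono2) auto
    also have "\<dots> = S - (r v - c)" unfolding S_def by (simp add: sum_diff1)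
    finally show ?thesis by simp
  qed
  have size: "(real (card P) - 1) * c \<le> (real t - 1) * c" if "P \<in> \<P>" for P
    using t[OF that] c0 by simp
  have part_sum': "(\<Sum>u\<in>P - {v}. r u) \<le> \<mu>" if "P \<in> \<P>" "v \<in> P" for P v
    using part_sum[OF that] size[OF that(1)] rc[of v] \<mu> by simp
  have adj: "(\<Sum>u | adjacent E v u. r u) = (\<Sum>P | P \<in> \<P> \<and> v \<in> P. \<Sum>u\<in>P - {v}. r u)" for v
    by (rule sum_adjacent_clique_partition[OF s part])
  have rv: "(\<Sum>P | P \<in> \<P> \<and> v \<in> P. \<mu>) = \<mu> * r v" for v
    by (simp add: r_def clique_degree_def)
  have row: "(\<Sum>u | adjacent E v u. r u) \<le> \<mu> * r v" for v
    unfolding adj rv[symmetric] using part_sum' by (intro sum_mono) auto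
  show "\<theta> \<le> \<mu>" by (rule eigenvalue_le_weighted_row_sum(1)[OF conn ev r0 row])
  assume "\<theta> = \<mu>"
  then have row_eq: "(\<Sum>u | adjacent E v u. r u) = \<mu> * r v" for v
    by (rule eigenvalue_le_weighted_row_sum(2)[OF conn ev r0 row])
  \<comment> \<open>The row sum attains a bound that holds part by part, so every part through
    \<open>v\<close> must attain it.\<close>
  have part_eq: "(\<Sum>u\<in>P - {v}. r u) = \<mu>" if "P \<in> \<P>" "v \<in> P" for P v
  proof (rule ccontr)
    assume "(\<Sum>u\<in>P - {v}. r u) \<noteq> \<mu>"
    then have "(\<Sum>u\<in>P - {v}. r u) < \<mu>" using part_sum'[OF that] by simp
    then have "(\<Sum>P | P \<in> \<P> \<and> v \<in> P. \<Sum>u\<in>P - {v}. r u) < (\<Sum>P | P \<in> \<P> \<and> v \<in> P. \<mu>)"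
      using part_sum' that by (intro sum_strict_mono_ex1) auto
    then show False using row_eq adj rv by (metis less_irrefl)
  qed
  have "clique_degree \<P> v \<noteq> 0" using r0[of v] by (simp add: r_def)
  then obtain Q where "Q \<in> \<P>" "v \<in> Q"
    unfolding clique_degree_def by (auto simp: card_eq_0_iff)
  then have "r v \<le> c" using part_sum[of Q v] part_eq[of Q v] size[of Q] \<mu> by simp
  then show "clique_degree \<P> v = c" using rc[of v] by (simp add: r_def)
  assume P: "P \<in> \<P>"
  then have "P \<noteq> {}" using part by (auto simp: clique_partition_def)
  then obtain u where "u \<in> P" by auto
  then have "(real t - 1) * c \<le> (real (card P) - 1) * c"
    using part_sum[OF P, of u] part_eq[OF P, of u] rc[of u] \<mu> by simp
  then have "t \<le> card P" using c0 by simp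
  then show "card P = t" using t[OF P] by simp
qed

section \<open>Partitions from decompositions and from edge-disjoint cliques\<close>

lemma clique_partition_of_decomposition:
  assumes "2 \<le> t" and "clique_decomposition t E \<D>"
  shows "clique_partition E \<D>" and "P \<in> \<D> \<Longrightarrow> card P = t"
  using assms by (auto simp: clique_partition_def clique_decomposition_def cliques_of_size_def)

definition uncovered_edges :: "'v::finite set set \<Rightarrow> 'v set set \<Rightarrow> 'v set set" where
  "uncovered_edges E \<Q> = {e \<in> E. \<forall>Q\<in>\<Q>. \<not> e \<subseteq> Q}"

text \<open>Edges are two-element vertex sets, so an uncovered edge is itself a part. It contains no
  edge but itself, and a covered edge lies in only one clique by disjointness.\<close>

lemma clique_partition_completion:
  assumes s: "simple_graph E" and t: "2 \<le> t"
    and Q: "\<Q> \<subseteq> cliques_of_size t E" and dis: "edge_disjoint E \<Q>"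
  shows "clique_partition E (\<Q> \<union> uncovered_edges E \<Q>)"
  unfolding clique_partition_def
proof (intro conjI ballI)
  fix P assume P: "P \<in> \<Q> \<union> uncovered_edges E \<Q>"
  have edge: "clique E e \<and> card e = 2" if "e \<in> E" for e
  proof -
    have "card e = 2" using s that by (simp add: simple_graph_def)
    moreover then obtain a b where "e = {a, b}" by (auto simp: card_2_iff)
    ultimately show ?thesis
      using that by (auto simp: clique_def adjacent_def insert_commute)
  qed
  show "clique E P" "2 \<le> card P"
    using P Q t edge by (auto simp: uncovered_edges_def cliques_of_size_def)
next
  fix e assume e: "e \<in> E"
  show "\<exists>!P. P \<in> \<Q> \<union> uncovered_edges E \<Q> \<and> e \<subseteq> P"
  proof (cases "\<exists>Q\<in>\<Q>. e \<subseteq> Q")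
    case True
    then obtain Q where Q1: "Q \<in> \<Q>" "e \<subseteq> Q" by auto
    show ?thesis
    proof (rule ex1I[of _ Q])
      fix P assume P: "P \<in> \<Q> \<union> uncovered_edges E \<Q> \<and> e \<subseteq> P"
      have "P \<notin> uncovered_edges E \<Q>"
      proof
        assume "P \<in> uncovered_edges E \<Q>"
        then have P1: "P \<in> E" "\<not> P \<subseteq> Q" using Q1 by (auto simp: uncovered_edges_def)
        then have "card e = card P" using e s by (simp add: simple_graph_def)
        then have "e = P" using P by (simp add: card_subset_eq)
        then show False using P1 Q1 by simp
      qed
      then show "P = Q" using P Q1 e dis unfolding edge_disjoint_def by blast
    qed (use Q1 in auto)
  next
    case False
    show ?thesis
    proof (rule ex1I[of _ e])
      fix P assume P: "P \<in> \<Q> \<union> uncovered_edges E \<Q> \<and> e \<subseteq> P"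
      then have "P \<in> E" using False by (auto simp: uncovered_edges_def)
      then have "card e = card P" using e s by (simp add: simple_graph_def)
      then show "P = e" using P card_subset_eq[of P e] by simp
    qed (use False e in \<open>auto simp: uncovered_edges_def\<close>)
  qed
qed

lemma sum_clique_partition_completion:
  fixes g :: "nat \<Rightarrow> nat"
  assumes "simple_graph E" and "2 < t" and "\<Q> \<subseteq> cliques_of_size t E"
  shows "(\<Sum>P\<in>\<Q> \<union> uncovered_edges E \<Q>. g (card P))
           = card \<Q> * g t + card (uncovered_edges E \<Q>) * g 2"
proof -
  have c: "card P = t" if "P \<in> \<Q>" for P using that assms(3) by (auto simp: cliques_of_size_def)
  have u: "card P = 2" if "P \<in> uncovered_edges E \<Q>" for P
    using that assms(1) by (auto simp: uncovered_edges_def simple_graph_def)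
  \<comment> \<open>Cliques of size \<open>t > 2\<close> cannot coincide with edges, so nothing is
    counted twice.\<close>
  have "\<Q> \<inter> uncovered_edges E \<Q> = {}" using c u assms(2) by fastforce
  then have "(\<Sum>P\<in>\<Q> \<union> uncovered_edges E \<Q>. g (card P))
      = (\<Sum>P\<in>\<Q>. g (card P)) + (\<Sum>P\<in>uncovered_edges E \<Q>. g (card P))"
    by (intro sum.union_disjoint) auto
  then show ?thesis using c u by simp
qed

section \<open>Families attaining the maximum number of edge-disjoint cliques\<close>

lemma finite_edge_disjoint_cards:
  fixes E :: "'v::finite set set"
  shows "finite {card \<Q> | \<Q>. \<Q> \<subseteq> cliques_of_size t E \<and> edge_disjoint E \<Q>}"
proof -
  have "{card \<Q> | \<Q>. \<Q> \<subseteq> cliques_of_size t E \<and> edge_disjoint E \<Q>} \<subseteq> card ` (UNIV :: 'v set set set)"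
    by blast
  then show ?thesis by (rule finite_subset) simp
qed

lemma max_edge_disjoint_cliques_obtain:
  obtains \<Q> where "\<Q> \<subseteq> cliques_of_size t E" "edge_disjoint E \<Q>"
    "card \<Q> = max_edge_disjoint_cliques t E"
proof -
  let ?S = "{card \<Q> | \<Q>. \<Q> \<subseteq> cliques_of_size t E \<and> edge_disjoint E \<Q>}"
  have "?S \<noteq> {}" by (auto simp: edge_disjoint_def intro!: exI[of _ "{}"])
  then have "Max ?S \<in> ?S" by (rule Max_in[OF finite_edge_disjoint_cards])
  then show ?thesis using that unfolding max_edge_disjoint_cliques_def by auto
qed

lemma card_le_max_edge_disjoint_cliques:
  assumes "\<Q> \<subseteq> cliques_of_size t E" and "edge_disjoint E \<Q>"
  shows "card \<Q> \<le> max_edge_disjoint_cliques t E"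
  unfolding max_edge_disjoint_cliques_def
  by (rule Max_ge[OF finite_edge_disjoint_cards]) (use assms in auto)

lemma card_decomposition_le_max:
  assumes "clique_decomposition t E \<D>"
  shows "card \<D> \<le> max_edge_disjoint_cliques t E"
  by (rule card_le_max_edge_disjoint_cliques)
     (use assms in \<open>unfold clique_decomposition_def edge_disjoint_def, blast+\<close>)

section \<open>The bound\<close>

text \<open>The edgeless graph is treated apart: there the minimum degree is 0, and clique degrees
  would not form a positive weight.\<close>

lemma spectral_radius_empty: "spectral_radius ({} :: 'v::finite set set) = 0"
proof -
  have "adjacency_matrix ({} :: 'v set set) = 0"
    by (simp add: adjacency_matrix_def adjacent_def vec_eq_iff)
  then obtain x :: "real^'v" where "x \<noteq> 0" "0 = spectral_radius ({} :: 'v set set) *s x"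
    using eigenvalue_spectral_radius[of "{} :: 'v set set"] unfolding eigenvalue_def by auto
  then show ?thesis by (metis vector_mul_eq_0)
qed

lemma max_edge_disjoint_cliques_empty:
  assumes "2 \<le> t"
  shows "max_edge_disjoint_cliques t ({} :: 'v::finite set set) = 0"
proof -
  have "cliques_of_size t ({} :: 'v set set) = {}"
  proof (rule equals0I)
    fix Q assume Q: "Q \<in> cliques_of_size t ({} :: 'v set set)"
    then obtain a b where "a \<in> Q" "b \<in> Q" "a \<noteq> b"
      using assms card_le_Suc0_iff_eq[of Q] by (auto simp: cliques_of_size_def)
    then show False using Q by (auto simp: cliques_of_size_def clique_def adjacent_def)
  qed
  then show ?thesis
    by (metis card.empty max_edge_disjoint_cliques_obtain subset_empty)
qed

lemma clique_number_bound:
  fixes E :: "'v::finite set set"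
  assumes t: "t > 2" and s: "simple_graph E" and conn: "connected_graph E" and ne: "E \<noteq> {}"
  defines "k \<equiv> real (max_edge_disjoint_cliques t E)"
    and "rhs \<equiv> 2 * real (card E) - spectral_radius E
          - (real CARD('v) - real t + 1) * real_of_int \<lceil>real (min_degree E) / (real t - 1)\<rceil>"
  shows "k * (real t * (real t - 2)) \<le> rhs"
    and "k * (real t * (real t - 2)) = rhs \<longleftrightarrow>
           regular_graph E \<and> (\<exists>\<Q>. clique_decomposition t E \<Q>)"
proof -
  obtain \<Q> where Q: "\<Q> \<subseteq> cliques_of_size t E" "edge_disjoint E \<Q>"
    and kQ: "card \<Q> = max_edge_disjoint_cliques t E"
    by (rule max_edge_disjoint_cliques_obtain)
  have k: "k = real (card \<Q>)" by (simp add: k_def kQ)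
  define \<P> where "\<P> = \<Q> \<union> uncovered_edges E \<Q>"
  define c where "c = real_of_int \<lceil>real (min_degree E) / (real t - 1)\<rceil>"
  define l where "l = real (card (uncovered_edges E \<Q>))"
  define n where "n = real CARD('v)"
  define T where "T = real t"
  have T2: "T > 2" using t by (simp add: T_def)
  have part: "clique_partition E \<P>"
    unfolding \<P>_def using clique_partition_completion[OF s _ Q] t by simp
  have Pt: "card P \<le> t" if "P \<in> \<P>" for P
    using that Q(1) s t by (auto simp: \<P>_def cliques_of_size_def uncovered_edges_def simple_graph_def)
  \<comment> \<open>With \<open>l\<close> uncovered edges, counting ordered pairs of adjacent
    vertices part by part gives \<open>k t (t - 1) + 2 l\<close>, and counting vertex-part
    incidences gives \<open>k t + 2 l\<close>.\<close>
  have "2 * card E = card \<Q> * (t * (t - 1)) + card (uncovered_edges E \<Q>) * (2 * (2 - 1))"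
    using two_card_edges_clique_partition[OF s part]
      sum_clique_partition_completion[OF s t Q(1), of "\<lambda>i. i * (i - 1)"]
    by (simp add: \<P>_def)
  then have "real (2 * card E)
      = real (card \<Q> * (t * (t - 1)) + card (uncovered_edges E \<Q>) * (2 * (2 - 1)))"
    by (rule arg_cong)
  then have edges: "2 * real (card E) = k * (T * (T - 1)) + 2 * l"
    using t by (simp add: k l_def of_nat_diff T_def)
  have "(\<Sum>v\<in>UNIV. clique_degree \<P> v) = card \<Q> * t + card (uncovered_edges E \<Q>) * 2"
    using sum_clique_degree[of \<P>] sum_clique_partition_completion[OF s t Q(1), of "\<lambda>i. i"]
    by (simp add: \<P>_def)
  then have "real (\<Sum>v\<in>UNIV. clique_degree \<P> v)
      = real (card \<Q> * t + card (uncovered_edges E \<Q>) * 2)"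
    by (rule arg_cong)
  then have sumr: "(\<Sum>v\<in>UNIV. real (clique_degree \<P> v)) = k * T + 2 * l"
    by (simp add: k l_def T_def)
  have \<delta>: "min_degree E > 0" by (rule min_degree_pos[OF s conn ne])
  have c0: "c > 0" unfolding c_def using \<delta> t by simp
  have cr: "c \<le> clique_degree \<P> v" for v
  proof -
    have "min_degree E \<le> (t - 1) * clique_degree \<P> v"
      using min_degree_le[of E v] vertex_degree_le_clique_degree[OF s part Pt, where v = v]
      by (rule order_trans)
    then have "real (min_degree E) \<le> real ((t - 1) * clique_degree \<P> v)"
      by (rule of_nat_mono)
    then have "real (min_degree E) \<le> (T - 1) * real (clique_degree \<P> v)"
      using t by (simp add: of_nat_diff T_def)
    then have "real (min_degree E) / (T - 1) \<le> real_of_int (int (clique_degree \<P> v))"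
      using T2 by (simp add: divide_le_eq mult.commute)
    then have "\<lceil>real (min_degree E) / (T - 1)\<rceil> \<le> int (clique_degree \<P> v)"
      by (rule ceiling_le)
    then show ?thesis unfolding c_def T_def by linarith
  qed
  define \<mu> where "\<mu> = (real t - 1) * c + (\<Sum>v\<in>UNIV. clique_degree \<P> v - c)"
  have \<mu>: "\<mu> = (T - 1) * c + k * T + 2 * l - n * c"
    by (simp add: \<mu>_def sum_subtractf sumr n_def T_def)
  note bound = eigenvalue_le_clique_partition[OF s conn part Pt c0 cr eigenvalue_spectral_radius,
      folded \<mu>_def]
  \<comment> \<open>The slack in the claimed inequality is exactly
    \<open>\<mu> - spectral_radius E\<close>, so both the bound and its equality case reduce to
    comparing these two numbers.\<close>
  have rhs: "rhs = k * (T * (T - 2)) + (\<mu> - spectral_radius E)"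
    unfolding rhs_def c_def[symmetric]
    unfolding n_def[symmetric] T_def[symmetric] edges \<mu>
    by (simp add: algebra_simps)
  show le: "k * (real t * (real t - 2)) \<le> rhs"
    using bound(1) rhs by (simp add: T_def)
  show "k * (real t * (real t - 2)) = rhs \<longleftrightarrow>
           regular_graph E \<and> (\<exists>\<Q>. clique_decomposition t E \<Q>)"
  proof
    assume "k * (real t * (real t - 2)) = rhs"
    then have eq: "spectral_radius E = \<mu>" using rhs by (simp add: T_def)
    have Pt': "card P = t" if "P \<in> \<P>" for P using bound(3)[OF _ eq that] by simp
    have "real (clique_degree \<P> v) = c" for v by (rule bound(2)[OF _ eq])
    then have "real (clique_degree \<P> v) = real (clique_degree \<P> w)" for v w by simp
    then have "vertex_degree E v = vertex_degree E w" for v w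
      using vertex_degree_uniform_clique_partition[OF s part Pt'] by simp
    then have "regular_graph E" unfolding regular_graph_def by blast
    \<comment> \<open>All parts now have size \<open>t > 2\<close>, which excludes edges as parts;
      the maximum family itself is then the decomposition.\<close>
    moreover have "uncovered_edges E \<Q> = {}"
    proof (rule equals0I)
      fix e assume e: "e \<in> uncovered_edges E \<Q>"
      then have "card e = 2" using s by (auto simp: uncovered_edges_def simple_graph_def)
      then show False using Pt'[of e] e t by (simp add: \<P>_def)
    qed
    then have "clique_decomposition t E \<Q>"
      using part Q(1) by (simp add: \<P>_def clique_partition_def clique_decomposition_def)
    ultimately show "regular_graph E \<and> (\<exists>\<Q>. clique_decomposition t E \<Q>)" by blast
  next
    assume "regular_graph E \<and> (\<exists>\<Q>. clique_decomposition t E \<Q>)"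
    then obtain d \<D> where d: "\<And>v. vertex_degree E v = d" and D: "clique_decomposition t E \<D>"
      unfolding regular_graph_def by blast
    have "2 \<le> t" using t by simp
    note Dpart = clique_partition_of_decomposition[OF this D]
    \<comment> \<open>The decomposition \<open>\<D>\<close> may differ from \<open>\<Q>\<close>, but
      it is no larger, and its cliques already use up all edges; hence \<open>\<Q>\<close> leaves
      none uncovered.\<close>
    have "2 * card E = card \<D> * (t * (t - 1))"
      using two_card_edges_clique_partition[OF s Dpart(1)] Dpart(2) by simp
    also have "\<dots> \<le> card \<Q> * (t * (t - 1))"
      using card_decomposition_le_max[OF D] kQ by simp
    finally have "real (2 * card E) \<le> real (card \<Q> * (t * (t - 1)))" by (rule of_nat_mono)
    then have "2 * real (card E) \<le> k * (T * (T - 1))"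
      using t by (simp add: k of_nat_diff T_def)
    then have l0: "l = 0" using edges by (simp add: l_def)
    have "real d = (T - 1) * clique_degree \<D> v" for v
      using vertex_degree_uniform_clique_partition[OF s Dpart, of v] d[of v] t
      by (simp add: of_nat_diff T_def)
    then have "real d / (T - 1) = real_of_int (int (clique_degree \<D> v))" for v
      using T2 by (simp add: field_simps)
    \<comment> \<open>The quotient is a clique degree in \<open>\<D>\<close>, hence an integer, so
      the ceiling is exact.\<close>
    then have "real_of_int \<lceil>real d / (T - 1)\<rceil> = real d / (T - 1)"
      by (metis ceiling_of_int)
    then have "c = real d / (T - 1)"
      by (simp add: c_def min_degree_regular[OF d] T_def)
    then have dc: "real d = (T - 1) * c" using T2 by simp
    have "2 * card E = CARD('v) * d"
      using sum_vertex_degree[OF s] by (simp add: d)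
    then have "real (2 * card E) = real (CARD('v) * d)" by (rule arg_cong)
    then have "k * (T * (T - 1)) = n * real d" using edges l0 by (simp add: n_def)
    then have "(k * T) * (T - 1) = (n * c) * (T - 1)" by (simp add: dc ac_simps)
    then have "k * T = n * c" using T2 by simp
    moreover have "real d \<le> spectral_radius E"
      by (rule eigenvalue_le_spectral_radius[OF eigenvalue_regular[OF s d]])
    \<comment> \<open>With \<open>l = 0\<close> and \<open>k * T = n * c\<close>, only
      \<open>(T - 1) * c = d\<close> remains of \<open>\<mu>\<close>, and \<open>d\<close> is an
      eigenvalue.\<close>
    ultimately have "\<mu> \<le> spectral_radius E" using \<mu> dc l0 by simp
    then show "k * (real t * (real t - 2)) = rhs"
      using bound(1) rhs by (simp add: T_def)
  qed
qed

theorem proposition4p2: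
  fixes E :: "'v::finite set set" and t :: nat
  assumes "t > 2" and "simple_graph E" and "connected_graph E"
  shows "let n = real CARD('v); m = real (card E);
             bound = (2 * m - spectral_radius E
                        - (n - real t + 1) * real_of_int \<lceil>real (min_degree E) / (real t - 1)\<rceil>)
                     / (real t * (real t - 2))
         in real (max_edge_disjoint_cliques t E) \<le> bound \<and>
            (real (max_edge_disjoint_cliques t E) = bound \<longleftrightarrow>
               regular_graph E \<and> (\<exists>\<Q>. clique_decomposition t E \<Q>))"
proof (cases "E = {}")
  case True
  \<comment> \<open>Without edges both sides of the bound are 0, and regularity and the empty
    decomposition hold trivially.\<close>
  have deg: "vertex_degree ({} :: 'v set set) v = 0" for v by (simp add: vertex_degree_def)
  have "clique_decomposition t ({} :: 'v set set) {}" by (simp add: clique_decomposition_def)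
  then have "\<exists>\<Q>. clique_decomposition t ({} :: 'v set set) \<Q>" by blast
  moreover have "regular_graph ({} :: 'v set set)" using deg by (auto simp: regular_graph_def)
  moreover have "min_degree ({} :: 'v set set) = 0" by (rule min_degree_regular[OF deg])
  ultimately show ?thesis
    using True assms(1) by (simp add: spectral_radius_empty max_edge_disjoint_cliques_empty)
next
  case False
  define D where "D = real t * (real t - 2)"
  have "D > 0" using assms(1) by (simp add: D_def)
  then show ?thesis
    using clique_number_bound[OF assms False, folded D_def]
    unfolding Let_def D_def[symmetric] by (simp add: pos_le_divide_eq eq_divide_eq)
qed

end
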